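(* Let $N=\{1,\dots,n\}$, $\mathbf{q}\in\mathbb{R}^n$, $\mathbf{c}\in\mathbb{R}^n_+$, and let $$\mathcal{P}^{\mathrm{MCMIX}}=\{(w,\mathbf{y},\mathbf{x})\in\mathbb{R}\times\mathbb{R}^n_+\times\{0,1\}^n: w\ge q_i-c_ix_i-y_i\ \forall i\in N\}.$$ Then $\operatorname{conv}(\mathcal{P}^{\mathrm{MCMIX}})$ is the set of all $(w,\mathbf{y},\mathbf{x})\in\mathbb{R}\times\mathbb{R}^n_+\times[0,1]^n$ satisfying the MISEPIs associated with $(1,\mathbf{u})$, $\mathbf{p}=\mathbf{0}$ and $\boldsymbol\delta$, i.e. $$w+\mathbf{u}^\top\mathbf{y}\ \ge\ F_{1,\mathbf{u}}(\mathbf{0})+\sum_{i=1}^n\Big[F_{1,\mathbf{u}}\Big(\sum_{j=1}^{i}\mathbf{1}^{\delta(j)}\Big)-F_{1,\mathbf{u}}\Big(\sum_{j=1}^{i-1}\mathbf{1}^{\delta(j)}\Big)\Big]x_{\delta(i)},$$ for all $\mathbf{u}\in\mathcal{U}'$ and all permutations $\boldsymbol\delta$ of $N$.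
   Context: With $h^i(\mathbf{x})=q_i-c_ix_i$, $F_{1,\mathbf{u}}(\mathbf{x})=\min_{j\in N}\{h^j(\mathbf{x})+\sum_{i\in N}u_i\max\{0,h^i(\mathbf{x})-h^j(\mathbf{x})\}\}$ for $\mathbf{x}\in\{0,1\}^n$. $\mathcal{U}'$ is the finite set of all $\mathbf{u}\in\mathbb{R}^n_+$ for which there exist a nonempty $M\subseteq N$ and a binary matrix $B\in\{0,1\}^{|M|\times|M|}$, invertible over $\mathbb{R}$, such that $\mathbf{u}^M=B^{-1}\mathbf{1}$ and $\mathbf{u}^{N\setminus M}=\mathbf{0}$, where $\mathbf{u}^M=[u_i]_{i\in M}$ and $\mathbf{1}$ is the all-ones vector. $\mathbf{1}^i$ is the $i$-th unit vector. *)

theory Defs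
  imports "HOL-Analysis.Analysis"
begin

(* The index set N = {1,...,n} is rendered by the finite type 'n, with n = CARD('n);
   accordingly a permutation of N is an enumeration of 'n, i.e. a bijection from {1..n} to 'n. *)

definition h_mix :: "real^'n \<Rightarrow> real^'n \<Rightarrow> 'n \<Rightarrow> real^'n \<Rightarrow> real" where
  "h_mix q c i x = q $ i - c $ i * x $ i"

definition F_mix :: "real^'n \<Rightarrow> real^'n \<Rightarrow> real^'n \<Rightarrow> real^'n \<Rightarrow> real" where
  "F_mix q c u x =
     Min (range (\<lambda>j. h_mix q c j x + (\<Sum>i\<in>UNIV. u $ i * max 0 (h_mix q c i x - h_mix q c j x))))"

definition P_MCMIX :: "real^'n \<Rightarrow> real^'n \<Rightarrow> (real \<times> (real^'n) \<times> (real^'n)) set" where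
  "P_MCMIX q c =
     {(w, y, x). (\<forall>i. 0 \<le> y $ i) \<and> (\<forall>i. x $ i \<in> {0, 1}) \<and>
                 (\<forall>i. w \<ge> q $ i - c $ i * x $ i - y $ i)}"

(* A square matrix of order |M| is a function on M \<times> M (its rows, too, are labelled by the
   elements of M); values outside M \<times> M are irrelevant. *)

definition inverse_matrix_on :: "'n set \<Rightarrow> ('n \<Rightarrow> 'n \<Rightarrow> real) \<Rightarrow> ('n \<Rightarrow> 'n \<Rightarrow> real) \<Rightarrow> bool" where
  "inverse_matrix_on M B C \<longleftrightarrow>
     (\<forall>i\<in>M. \<forall>k\<in>M. (\<Sum>j\<in>M. B i j * C j k) = (if i = k then 1 else 0)) \<and>
     (\<forall>i\<in>M. \<forall>k\<in>M. (\<Sum>j\<in>M. C i j * B j k) = (if i = k then 1 else 0))"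

definition U' :: "(real^'n) set" where
  "U' = {u. (\<forall>i. 0 \<le> u $ i) \<and>
            (\<exists>M B C. M \<noteq> {} \<and> (\<forall>i\<in>M. \<forall>j\<in>M. B i j \<in> {0, 1}) \<and>
                     inverse_matrix_on M B C \<and>
                     (\<forall>i\<in>M. u $ i = (\<Sum>j\<in>M. C i j * 1)) \<and>
                     (\<forall>i. i \<notin> M \<longrightarrow> u $ i = 0))}"

definition unit_sum :: "(nat \<Rightarrow> 'n) \<Rightarrow> nat \<Rightarrow> real^'n" where
  "unit_sum \<delta> k = (\<Sum>j = 1..k. axis (\<delta> j) 1)"

(* The MISEPI associated with (1, u), p = 0 and \<delta>. *)

definition MISEPI ::
    "real^'n \<Rightarrow> real^'n \<Rightarrow> real^'n \<Rightarrow> (nat \<Rightarrow> 'n) \<Rightarrow> real \<Rightarrow> real^'n \<Rightarrow> real^'n \<Rightarrow> bool" where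
  "MISEPI q c u \<delta> w y x \<longleftrightarrow>
     w + u \<bullet> y \<ge> F_mix q c u 0 +
       (\<Sum>i = 1..CARD('n). (F_mix q c u (unit_sum \<delta> i) - F_mix q c u (unit_sum \<delta> (i - 1))) * x $ \<delta> i)"

end

theory Submission
  imports Defs
begin

text \<open>
  If \<open>u \<ge> 0\<close> has total weight at least 1, then \<open>F(x)\<close> is the minimum of
  \<open>w + \<Sum>i. u i * max 0 (h i x - w)\<close> over all real \<open>w\<close>, and it is submodular in \<open>x\<close>; so the
  greedy inequalities are valid. Conversely, a point outside the convex hull is strictly
  separated from the sum of the recession cone and the hull of the finitely many kinks. The
  recession cone makes the coefficients \<open>(1, u)\<close> of the separating functional satisfy
  \<open>u \<ge> 0\<close> and \<open>\<Sum>i. u i \<ge> 1\<close>; averaging along the chain that sorts \<open>x\<close> cancels the part of the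
  functional acting on \<open>x\<close> and shows that \<open>u\<close> yields a violated greedy inequality. Its violation
  is affine in \<open>u\<close> as long as no \<open>u i\<close> changes sign and no subset sum of \<open>u\<close> crosses 1, so \<open>u\<close>
  can be moved, still violating, until the tight equations among \<open>u i = 0\<close> and
  \<open>\<Sum>i\<in>T. u i = 1\<close> determine it, that is, into \<open>U'\<close>.
\<close>

subsection \<open>The hinge function and its minimum\<close>

text \<open>When \<open>a i\<close> is \<open>h_mix q c i x\<close>, this is
  \<open>w + u \<bullet> y\<close> at the least \<open>y\<close> that is feasible for
  \<open>w\<close> and a binary \<open>x\<close>.\<close>

definition hinge :: "real^'n \<Rightarrow> ('n \<Rightarrow> real) \<Rightarrow> real \<Rightarrow> real" where
  "hinge u a w = w + (\<Sum>i\<in>UNIV. u $ i * max 0 (a i - w))"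

text \<open>Serves both as the binary point given by a set and as the normal whose inner product
  with \<open>u\<close> is a subset sum.\<close>

definition indvec :: "'n set \<Rightarrow> real^'n" where
  "indvec T = (\<chi> i. if i \<in> T then 1 else 0)"

lemma indvec_nth [simp]: "indvec T $ i = (if i \<in> T then 1 else 0)"
  by (simp add: indvec_def)

lemma indvec_inner: "indvec T \<bullet> u = (\<Sum>i\<in>T. u $ i)"
  by (simp add: inner_vec_def if_distrib[of "\<lambda>s. s * _"] sum.If_cases)

lemma F_mix_hinge:
  "F_mix q c u x = Min (range (\<lambda>j. hinge u (\<lambda>i. h_mix q c i x) (h_mix q c j x)))"
  by (simp add: F_mix_def hinge_def)

lemma F_mix_le: "F_mix q c u x \<le> hinge u (\<lambda>i. h_mix q c i x) (h_mix q c j x)"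
  unfolding F_mix_hinge by (rule Min_le) auto

lemma F_mix_attained:
  obtains j where "F_mix q c u x = hinge u (\<lambda>i. h_mix q c i x) (h_mix q c j x)"
proof -
  have "F_mix q c u x \<in> range (\<lambda>j. hinge u (\<lambda>i. h_mix q c i x) (h_mix q c j x))"
    unfolding F_mix_hinge by (rule Min_in) auto
  then show ?thesis using that by auto
qed

text \<open>Since \<open>u\<close> is nonnegative, the hinge is convex in its last argument. At
  \<open>v\<close> its left slope is 1 minus the weight of \<open>{i. v \<le> a i}\<close> and its
  right slope 1 minus that of \<open>{i. v < a i}\<close>; by assumption 0 lies between
  them.\<close>

lemma hinge_minimizer:
  fixes u :: "real^'n"
  assumes u: "\<And>i. 0 \<le> u $ i"
    and above: "indvec {i. v < a i} \<bullet> u \<le> 1" and upto: "1 \<le> indvec {i. v \<le> a i} \<bullet> u"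
  shows "hinge u a v \<le> hinge u a w"
proof (cases "w \<le> v")
  case True
  have "(\<Sum>i\<in>UNIV. u $ i * max 0 (a i - v)) + (v - w) * 1
      \<le> (\<Sum>i\<in>UNIV. u $ i * max 0 (a i - v)) + (v - w) * (\<Sum>i\<in>UNIV. if v \<le> a i then u $ i else 0)"
    using upto True
    by (intro add_left_mono mult_left_mono) (auto simp: indvec_inner sum.If_cases)
  also have "\<dots> = (\<Sum>i\<in>UNIV. u $ i * max 0 (a i - v) + (v - w) * (if v \<le> a i then u $ i else 0))"
    by (simp add: sum.distrib sum_distrib_left)
  also have "\<dots> \<le> (\<Sum>i\<in>UNIV. u $ i * max 0 (a i - w))"
  proof (rule sum_mono)
    fix i
    have "u $ i * max 0 (a i - v) + (v - w) * (if v \<le> a i then u $ i else 0)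
        = u $ i * (max 0 (a i - v) + (if v \<le> a i then v - w else 0))"
      by (simp add: algebra_simps)
    also have "\<dots> \<le> u $ i * max 0 (a i - w)"
      using True by (intro mult_left_mono u) auto
    finally show "u $ i * max 0 (a i - v) + (v - w) * (if v \<le> a i then u $ i else 0)
        \<le> u $ i * max 0 (a i - w)" .
  qed
  finally show ?thesis by (simp add: hinge_def)
next
  case False
  have "(\<Sum>i\<in>UNIV. u $ i * max 0 (a i - v))
      \<le> (\<Sum>i\<in>UNIV. u $ i * max 0 (a i - w) + (w - v) * (if v < a i then u $ i else 0))"
  proof (rule sum_mono)
    fix i
    have "u $ i * max 0 (a i - v) \<le> u $ i * (max 0 (a i - w) + (if v < a i then w - v else 0))"
      using False by (intro mult_left_mono u) auto
    also have "\<dots> = u $ i * max 0 (a i - w) + (w - v) * (if v < a i then u $ i else 0)"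
      by (simp add: algebra_simps)
    finally show "u $ i * max 0 (a i - v)
        \<le> u $ i * max 0 (a i - w) + (w - v) * (if v < a i then u $ i else 0)" .
  qed
  also have "\<dots> = (\<Sum>i\<in>UNIV. u $ i * max 0 (a i - w))
      + (w - v) * (\<Sum>i\<in>UNIV. if v < a i then u $ i else 0)"
    by (simp add: sum.distrib sum_distrib_left)
  also have "\<dots> \<le> (\<Sum>i\<in>UNIV. u $ i * max 0 (a i - w)) + (w - v) * 1"
    using above False
    by (intro add_left_mono mult_left_mono) (auto simp: indvec_inner sum.If_cases)
  finally show ?thesis by (simp add: hinge_def)
qed

text \<open>Take the largest breakpoint at or above which weight at least 1 still lies; the smallest
  breakpoint collects all of the weight.\<close>

lemma hinge_breakpoint:
  fixes u :: "real^'n" and a :: "'n \<Rightarrow> real"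
  assumes "1 \<le> indvec UNIV \<bullet> u"
  obtains j where "indvec {i. a j < a i} \<bullet> u \<le> 1" "1 \<le> indvec {i. a j \<le> a i} \<bullet> u"
proof -
  define G where "G = {v \<in> range a. 1 \<le> indvec {i. v \<le> a i} \<bullet> u}"
  have fin: "finite G" by (simp add: G_def)
  have "{i. Min (range a) \<le> a i} = UNIV" by auto
  then have "Min (range a) \<in> G" using assms by (simp add: G_def Min_in)
  then have "Max G \<in> G" using fin by (intro Max_in) auto
  then obtain j where j: "Max G = a j" "1 \<le> indvec {i. a j \<le> a i} \<bullet> u" by (auto simp: G_def)
  have "indvec {i. a j < a i} \<bullet> u \<le> 1"
  proof (rule ccontr)
    assume "\<not> ?thesis"
    then have big: "1 < indvec {i. a j < a i} \<bullet> u" by simp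
    \<comment> \<open>If the weight strictly above \<open>a j\<close> exceeded 1, the next larger
      breakpoint \<open>v\<close> would lie in \<open>G\<close> too, against maximality.\<close>
    define A where "A = {i. a j < a i}"
    have "A \<noteq> {}" using big unfolding A_def[symmetric] by (auto simp: indvec_inner)
    define v where "v = Min (a ` A)"
    have vA: "v \<in> a ` A" unfolding v_def using \<open>A \<noteq> {}\<close> by (intro Min_in) auto
    have "{i. v \<le> a i} = A"
    proof (intro set_eqI iffI)
      fix i assume "i \<in> {i. v \<le> a i}"
      moreover have "a j < v" using vA by (auto simp: A_def)
      ultimately show "i \<in> A" by (auto simp: A_def)
    qed (simp add: v_def)
    then have "v \<in> G" using vA big by (auto simp: G_def A_def)
    then have "v \<le> a j" using Max_ge[OF fin] j by metis
    moreover have "a j < v" using vA by (auto simp: A_def)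
    ultimately show False by simp
  qed
  then show ?thesis using that j by blast
qed

text \<open>For fixed \<open>j\<close> the right-hand side is affine in \<open>u\<close>, and the
  conditions on \<open>j\<close> involve \<open>u\<close> only through signs and comparisons of
  subset sums with 1. This makes \<open>F_mix\<close> piecewise affine in \<open>u\<close>.\<close>

lemma F_mix_eqI:
  assumes "\<And>i. 0 \<le> u $ i"
    and "indvec {i. h_mix q c j x < h_mix q c i x} \<bullet> u \<le> 1"
    and "1 \<le> indvec {i. h_mix q c j x \<le> h_mix q c i x} \<bullet> u"
  shows "F_mix q c u x = hinge u (\<lambda>i. h_mix q c i x) (h_mix q c j x)"
  by (metis F_mix_attained F_mix_le antisym hinge_minimizer[where a = "\<lambda>i. h_mix q c i x", OF assms])

lemma F_mix_le_hinge:
  assumes "\<And>i. 0 \<le> u $ i" "1 \<le> indvec UNIV \<bullet> u"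
  shows "F_mix q c u x \<le> hinge u (\<lambda>i. h_mix q c i x) w"
proof -
  obtain j where j: "indvec {i. h_mix q c j x < h_mix q c i x} \<bullet> u \<le> 1"
      "1 \<le> indvec {i. h_mix q c j x \<le> h_mix q c i x} \<bullet> u"
    using hinge_breakpoint[OF assms(2)] .
  show ?thesis
    unfolding F_mix_eqI[OF assms(1) j] by (rule hinge_minimizer[OF assms(1) j])
qed

text \<open>At the largest \<open>h_mix q c j x\<close> all positive parts vanish. The bound is
  independent of \<open>u\<close> and later excludes descent along an unbounded ray.\<close>

lemma F_mix_le_Max: "F_mix q c u x \<le> Max (range (\<lambda>i. h_mix q c i x))"
proof -
  have "Max (range (\<lambda>i. h_mix q c i x)) \<in> range (\<lambda>i. h_mix q c i x)"
    by (rule Max_in) auto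
  then obtain j where j: "Max (range (\<lambda>i. h_mix q c i x)) = h_mix q c j x" by fastforce
  have "h_mix q c i x \<le> h_mix q c j x" for i
    unfolding j[symmetric] by (rule Max_ge) auto
  then have "max 0 (h_mix q c i x - h_mix q c j x) = 0" for i
    by (simp add: max.absorb1)
  then have "hinge u (\<lambda>i. h_mix q c i x) (h_mix q c j x) = h_mix q c j x"
    by (simp add: hinge_def)
  then show ?thesis using F_mix_le[of q c u x j] j by simp
qed

text \<open>The hinge is a convex function of the difference \<open>a i - w\<close>, hence submodular in \<open>(w, a)\<close>;
  partial minimization over \<open>w\<close> preserves submodularity.\<close>

lemma F_mix_submodular:
  fixes u :: "real^'n"
  assumes u: "\<And>i. 0 \<le> u $ i" "1 \<le> indvec UNIV \<bullet> u" and c: "\<And>i. 0 \<le> c $ i"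
  shows "F_mix q c u (indvec (A \<union> B)) + F_mix q c u (indvec (A \<inter> B))
    \<le> F_mix q c u (indvec A) + F_mix q c u (indvec B)"
proof -
  let ?h = "\<lambda>S i. h_mix q c i (indvec S)"
  obtain j where j: "F_mix q c u (indvec A) = hinge u (?h A) (?h A j)"
    by (rule F_mix_attained)
  obtain k where k: "F_mix q c u (indvec B) = hinge u (?h B) (?h B k)"
    by (rule F_mix_attained)
  define v w where "v = ?h A j" and "w = ?h B k"
  \<comment> \<open>The minimizers \<open>v\<close> for \<open>A\<close> and \<open>w\<close> for
    \<open>B\<close> yield the trial points \<open>min v w\<close> for the union and
    \<open>max v w\<close> for the intersection.\<close>
  have "F_mix q c u (indvec (A \<union> B)) + F_mix q c u (indvec (A \<inter> B))
      \<le> hinge u (?h (A \<union> B)) (min v w) + hinge u (?h (A \<inter> B)) (max v w)"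
    by (intro add_mono F_mix_le_hinge u)
  also have "\<dots> = v + w + (\<Sum>i\<in>UNIV. u $ i *
      (max 0 (?h (A \<union> B) i - min v w) + max 0 (?h (A \<inter> B) i - max v w)))"
    by (simp add: hinge_def sum.distrib distrib_left)
  also have "\<dots> \<le> v + w + (\<Sum>i\<in>UNIV. u $ i *
      (max 0 (?h A i - v) + max 0 (?h B i - w)))"
  proof (intro add_left_mono sum_mono mult_left_mono u)
    fix i
    have "?h (A \<union> B) i = min (?h A i) (?h B i)" "?h (A \<inter> B) i = max (?h A i) (?h B i)"
      using c[of i] by (auto simp: h_mix_def)
    moreover have "max 0 (min s t - min v w) + max 0 (max s t - max v w)
        \<le> max 0 (s - v) + max 0 (t - w)" for s t :: real
      by (simp add: min_def max_def)
    ultimately show "max 0 (?h (A \<union> B) i - min v w) + max 0 (?h (A \<inter> B) i - max v w)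
        \<le> max 0 (?h A i - v) + max 0 (?h B i - w)"
      by metis
  qed
  also have "\<dots> = F_mix q c u (indvec A) + F_mix q c u (indvec B)"
    unfolding j k by (simp add: hinge_def sum.distrib distrib_left v_def w_def)
  finally show ?thesis .
qed

section \<open>Validity of the greedy inequalities\<close>

lemma unit_sum_indvec:
  fixes \<delta> :: "nat \<Rightarrow> 'n::finite"
  assumes "bij_betw \<delta> {1..CARD('n)} UNIV" "k \<le> CARD('n)"
  shows "unit_sum \<delta> k = indvec (\<delta> ` {1..k})"
proof -
  have inj: "inj_on \<delta> {1..k}"
    using assms by (auto simp: bij_betw_def intro: inj_on_subset)
  have "unit_sum \<delta> k = (\<Sum>l\<in>\<delta> ` {1..k}. axis l 1)"
    unfolding unit_sum_def by (simp only: sum.reindex[OF inj] comp_def)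
  also have "\<dots> = indvec (\<delta> ` {1..k})"
    by (simp add: vec_eq_iff axis_def if_distrib cong: if_cong)
  finally show ?thesis .
qed

text \<open>By submodularity, adding \<open>\<delta> (Suc k)\<close> to a full prefix increases
  \<open>F_mix\<close> by at most as much as adding it to the part of the prefix in
  \<open>X\<close>. Summing over the members of \<open>X\<close> leads to \<open>F_mix\<close> at
  \<open>x\<close>, which the hinge at the given \<open>w\<close> bounds.\<close>

lemma MISEPI_binary:
  fixes u :: "real^'n"
  assumes u: "\<And>i. 0 \<le> u $ i" "1 \<le> indvec UNIV \<bullet> u" and c: "\<And>i. 0 \<le> c $ i"
    and \<delta>: "bij_betw \<delta> {1..CARD('n)} UNIV"
    and p: "(w, y, x) \<in> P_MCMIX q c"
  shows "MISEPI q c u \<delta> w y x"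
proof -
  let ?F = "F_mix q c u"
  define X where "X = {i. x $ i = 1}"
  have x: "x = indvec X"
    using p by (auto simp: P_MCMIX_def X_def vec_eq_iff)
  have greedy: "?F 0 + (\<Sum>i = 1..k. (?F (unit_sum \<delta> i) - ?F (unit_sum \<delta> (i - 1))) * x $ \<delta> i)
      \<le> ?F (indvec (X \<inter> \<delta> ` {1..k}))" if "k \<le> CARD('n)" for k
    using that
  proof (induction k)
    case 0
    then show ?case by (simp add: vec_eq_iff[of 0] zero_vec_def indvec_def)
  next
    case (Suc k)
    let ?S = "\<delta> ` {1..k}" and ?S' = "\<delta> ` {1..Suc k}"
    have S': "?S' = insert (\<delta> (Suc k)) ?S" by (simp add: atLeastAtMostSuc_conv)
    have notin: "\<delta> (Suc k) \<notin> ?S"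
    proof
      assume "\<delta> (Suc k) \<in> ?S"
      then obtain i where "i \<in> {1..k}" "\<delta> (Suc k) = \<delta> i" by auto
      then show False
        using \<delta> Suc.prems inj_onD[of \<delta> "{1..CARD('n)}" "Suc k" i] by (auto simp: bij_betw_def)
    qed
    show ?case
    proof (cases "\<delta> (Suc k) \<in> X")
      case True
      have "X \<inter> ?S' \<union> ?S = ?S'" "X \<inter> ?S' \<inter> ?S = X \<inter> ?S"
        using True S' by auto
      then have "?F (indvec ?S') + ?F (indvec (X \<inter> ?S)) \<le> ?F (indvec (X \<inter> ?S')) + ?F (indvec ?S)"
        using F_mix_submodular[OF u c, of q "X \<inter> ?S'" ?S] by simp
      then show ?thesis
        using Suc True by (simp add: x unit_sum_indvec[OF \<delta>])
    next
      case False
      then have "X \<inter> ?S' = X \<inter> ?S" using S' by auto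
      then show ?thesis using Suc False by (simp add: x)
    qed
  qed
  have "?F x \<le> hinge u (\<lambda>i. h_mix q c i x) w"
    by (rule F_mix_le_hinge[OF u])
  also have "\<dots> \<le> w + u \<bullet> y"
    using p unfolding hinge_def inner_vec_def
    by (auto simp: P_MCMIX_def h_mix_def algebra_simps intro!: sum_mono mult_left_mono u)
  finally have "?F x \<le> w + u \<bullet> y" .
  then show ?thesis
    using greedy[of "CARD('n)"] \<delta> by (simp add: MISEPI_def x bij_betw_def)
qed


text \<open>One row of \<open>B\<close> suffices: its product with \<open>u\<close> is 1, and its
  entries are at most 1 while \<open>u\<close> is nonnegative.\<close>

lemma U'_sum_ge_1:
  assumes "u \<in> U'"
  shows "1 \<le> indvec UNIV \<bullet> u"
proof -
  obtain M B C where M: "M \<noteq> {}" "\<forall>i\<in>M. \<forall>j\<in>M. B i j \<in> {0, 1::real}"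
      "inverse_matrix_on M B C" "\<forall>i\<in>M. u $ i = (\<Sum>j\<in>M. C i j * 1)" and u: "\<forall>i. 0 \<le> u $ i"
    using assms unfolding U'_def by blast
  obtain i where i: "i \<in> M" using M by blast
  have "(\<Sum>j\<in>M. B i j * u $ j) = (\<Sum>j\<in>M. \<Sum>k\<in>M. B i j * C j k)"
    using M by (simp add: sum_distrib_left)
  also have "\<dots> = (\<Sum>k\<in>M. \<Sum>j\<in>M. B i j * C j k)"
    by (rule sum.swap)
  also have "\<dots> = (\<Sum>k\<in>M. if i = k then 1 else 0)"
    using M(3) i by (simp add: inverse_matrix_on_def)
  also have "\<dots> = 1" using i by simp
  finally have "1 = (\<Sum>j\<in>M. B i j * u $ j)" ..
  also have "\<dots> \<le> (\<Sum>j\<in>M. u $ j)"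
  proof (rule sum_mono)
    fix j assume "j \<in> M"
    then have "B i j \<in> {0, 1}" using M(2) i by blast
    then show "B i j * u $ j \<le> u $ j" using u by auto
  qed
  also have "\<dots> \<le> (\<Sum>j\<in>UNIV. u $ j)"
    by (rule sum_mono2) (use u in auto)
  finally show ?thesis by (simp add: indvec_inner)
qed

subsection \<open>Moving the weights to a vertex\<close>

text \<open>The right-hand side of the inequality as a linear functional of the values
  \<open>f k\<close> along a chain; \<open>z i\<close> stands for
  \<open>x $ \<delta> i\<close>.\<close>

definition greedy :: "(nat \<Rightarrow> real) \<Rightarrow> nat \<Rightarrow> (nat \<Rightarrow> real) \<Rightarrow> real" where
  "greedy z n f = f 0 + (\<Sum>i = 1..n. (f i - f (i - 1)) * z i)"

lemma MISEPI_greedy: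
  fixes u :: "real^'n"
  shows "MISEPI q c u \<delta> w y x \<longleftrightarrow>
    greedy (\<lambda>i. x $ \<delta> i) CARD('n) (\<lambda>k. F_mix q c u (unit_sum \<delta> k)) \<le> w + u \<bullet> y"
  by (simp add: MISEPI_def greedy_def unit_sum_def)

lemma greedy_add: "greedy z n (\<lambda>k. f k + g k) = greedy z n f + greedy z n g"
  by (simp add: greedy_def sum.distrib[symmetric] algebra_simps)

lemma greedy_mult: "greedy z n (\<lambda>k. t * f k) = t * greedy z n f"
  by (simp add: greedy_def sum_distrib_left algebra_simps)

text \<open>By Abel summation, the greedy value is an average of the values of \<open>f\<close>.\<close>

lemma greedy_ge:
  assumes f: "\<And>k. k \<le> n \<Longrightarrow> m \<le> f k"
    and z: "\<And>i. 0 \<le> z i" "\<And>i. z i \<le> 1" "\<And>i j. 1 \<le> i \<Longrightarrow> i \<le> j \<Longrightarrow> j \<le> n \<Longrightarrow> z j \<le> z i"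
  shows "m \<le> greedy z n f"
proof -
  \<comment> \<open>With the default 1 at index 0, the weights \<open>z' k - z' (Suc k)\<close> and
    the final \<open>z' n\<close> sum to 1. In the invariant below, \<open>m\<close> replaces the
    values before \<open>f k\<close>, and \<open>f k\<close> carries the remaining weight
    \<open>z' k\<close>.\<close>
  define z' where "z' k = (if k = 0 then 1 else z k)" for k
  have "m * (1 - z' k) + f k * z' k \<le> greedy z k f" if "k \<le> n" for k
    using that
  proof (induction k)
    case 0
    then show ?case by (simp add: greedy_def z'_def)
  next
    case (Suc k)
    have "z' (Suc k) \<le> z' k" using z Suc.prems by (auto simp: z'_def)
    then have "0 \<le> (f k - m) * (z' k - z' (Suc k))"
      using f[of k] Suc.prems by (intro mult_nonneg_nonneg) auto
    moreover have "greedy z (Suc k) f = greedy z k f + (f (Suc k) - f k) * z' (Suc k)"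
      by (simp add: greedy_def z'_def)
    ultimately show ?case using Suc by (simp add: algebra_simps)
  qed
  from this[of n] have "m * (1 - z' n) + f n * z' n \<le> greedy z n f" by simp
  moreover have "0 \<le> (f n - m) * z' n"
    using f z by (intro mult_nonneg_nonneg) (auto simp: z'_def)
  ultimately show ?thesis by (simp add: algebra_simps)
qed

lemma greedy_le:
  assumes f: "\<And>k. k \<le> n \<Longrightarrow> f k \<le> m"
    and z: "\<And>i. 0 \<le> z i" "\<And>i. z i \<le> 1" "\<And>i j. 1 \<le> i \<Longrightarrow> i \<le> j \<Longrightarrow> j \<le> n \<Longrightarrow> z j \<le> z i"
  shows "greedy z n f \<le> m"
proof -
  have "- m \<le> greedy z n (\<lambda>k. (-1) * f k)"
    by (rule greedy_ge) (use f z in auto)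
  then show ?thesis unfolding greedy_mult by simp
qed

text \<open>A pair \<open>(v, b)\<close> stands for the hyperplane \<open>v \<bullet> u = b\<close>.\<close>

definition faces :: "((real^'n) \<times> real) set" where
  "faces = range (\<lambda>i. (axis i 1, 0)) \<union> range (\<lambda>T. (indvec T, 1))"

definition tight :: "real^'n \<Rightarrow> ((real^'n) \<times> real) set" where
  "tight u = {p \<in> faces. fst p \<bullet> u = snd p}"

text \<open>With weak inequalities in both directions, equations tight at \<open>u\<close> stay
  tight, and other faces may be reached but not crossed. The relation is not symmetric.\<close>

definition same_side :: "real^'n \<Rightarrow> real^'n \<Rightarrow> bool" where
  "same_side u u' \<longleftrightarrow> (\<forall>p\<in>faces. (fst p \<bullet> u \<le> snd p \<longrightarrow> fst p \<bullet> u' \<le> snd p) \<and>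
                               (snd p \<le> fst p \<bullet> u \<longrightarrow> snd p \<le> fst p \<bullet> u'))"

lemma finite_faces: "finite (faces :: ((real^'n) \<times> real) set)"
  by (simp add: faces_def)

lemma same_side_nonneg:
  assumes "same_side u u'" "0 \<le> u $ i"
  shows "0 \<le> u' $ i"
proof -
  have "(axis i 1, 0) \<in> faces" by (simp add: faces_def)
  with assms show ?thesis by (force simp: same_side_def inner_axis')
qed

lemma same_side_indvec:
  assumes "same_side u u'"
  shows "indvec T \<bullet> u \<le> 1 \<Longrightarrow> indvec T \<bullet> u' \<le> 1" "1 \<le> indvec T \<bullet> u \<Longrightarrow> 1 \<le> indvec T \<bullet> u'"
proof -
  have "(indvec T, 1) \<in> faces" by (simp add: faces_def)
  with assms show "indvec T \<bullet> u \<le> 1 \<Longrightarrow> indvec T \<bullet> u' \<le> 1"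
      "1 \<le> indvec T \<bullet> u \<Longrightarrow> 1 \<le> indvec T \<bullet> u'"
    by (force simp: same_side_def)+
qed

text \<open>Orthogonality to the tight normals preserves the tight equations. The other faces meet
  the ray at finitely many times; the earliest one adds a tight equation before any face is crossed,
  and if there is none, no face is ever crossed.\<close>

lemma first_hit:
  fixes u d :: "real^'n"
  assumes d: "\<And>p. p \<in> tight u \<Longrightarrow> fst p \<bullet> d = 0"
  obtains (hit) t where "0 < t" "tight u \<subset> tight (u + t *\<^sub>R d)" "same_side u (u + t *\<^sub>R d)"
    | (free) "\<And>t. 0 \<le> t \<Longrightarrow> same_side u (u + t *\<^sub>R d)"
proof -
  define H where "H = {t. 0 < t \<and> (\<exists>p\<in>faces. fst p \<bullet> u \<noteq> snd p \<and> fst p \<bullet> (u + t *\<^sub>R d) = snd p)}"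
  have "H \<subseteq> (\<lambda>p. (snd p - fst p \<bullet> u) / (fst p \<bullet> d)) ` faces"
  proof
    fix t assume "t \<in> H"
    then obtain p where p: "p \<in> faces" "fst p \<bullet> u \<noteq> snd p" "fst p \<bullet> u + t * (fst p \<bullet> d) = snd p"
      by (auto simp: H_def inner_add_right)
    then have "fst p \<bullet> d \<noteq> 0" by auto
    then have "t = (snd p - fst p \<bullet> u) / (fst p \<bullet> d)"
      using p(3) by (simp add: nonzero_eq_divide_eq)
    with p show "t \<in> (\<lambda>p. (snd p - fst p \<bullet> u) / (fst p \<bullet> d)) ` faces" by blast
  qed
  then have fin: "finite H" using finite_faces finite_surj by blast
  \<comment> \<open>Each face functional is affine along the ray, so a face crossed by time
    \<open>t\<close> was met at a strictly earlier positive time.\<close>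
  have crossed: "\<exists>s\<in>H. s < t" if t: "0 \<le> t" and crossing: "\<not> same_side u (u + t *\<^sub>R d)" for t
  proof -
    obtain p where p: "p \<in> faces"
        "fst p \<bullet> u \<le> snd p \<and> snd p < fst p \<bullet> u + t * (fst p \<bullet> d) \<or>
         snd p \<le> fst p \<bullet> u \<and> fst p \<bullet> u + t * (fst p \<bullet> d) < snd p"
      using crossing by (force simp: same_side_def inner_add_right)
    define g b a where "g = fst p \<bullet> d" and "b = snd p" and "a = fst p \<bullet> u"
    have "a \<noteq> b" using p d[of p] by (auto simp: tight_def a_def b_def)
    then have ab: "a < b \<and> b < a + t * g \<or> b < a \<and> a + t * g < b"
      using p by (auto simp: g_def b_def a_def)
    have g: "0 < g \<and> a < b \<and> b < a + t * g \<or> g < 0 \<and> b < a \<and> a + t * g < b"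
    proof (cases "a < b")
      case True
      then have "0 < t * g" using ab by auto
      then show ?thesis using ab True t by (auto simp: zero_less_mult_iff)
    next
      case False
      then have "t * g < 0" using ab by auto
      then show ?thesis using ab False t by (auto simp: mult_less_0_iff)
    qed
    define s where "s = (b - a) / g"
    have "0 < s" "s < t" "a + s * g = b"
      using g by (auto simp: s_def field_simps)
    moreover have "s \<in> H"
      using calculation p(1) \<open>a \<noteq> b\<close>
      by (auto simp: H_def inner_add_right a_def b_def g_def intro!: bexI[of _ p])
    ultimately show ?thesis by blast
  qed
  show ?thesis
  proof (cases "H = {}")
    case True
    then show ?thesis using free crossed by blast
  next
    case False
    define t where "t = Min H"
    have t: "t \<in> H" "\<And>s. s \<in> H \<Longrightarrow> t \<le> s"
      using fin False by (auto simp: t_def Min_in)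
    then have "0 < t" by (simp add: H_def)
    moreover have "same_side u (u + t *\<^sub>R d)"
      using crossed[of t] t(2) \<open>0 < t\<close> by fastforce
    moreover have "tight u \<subset> tight (u + t *\<^sub>R d)"
    proof
      show "tight u \<subseteq> tight (u + t *\<^sub>R d)"
        using d by (auto simp: tight_def inner_add_right)
      show "tight u \<noteq> tight (u + t *\<^sub>R d)"
        using t(1) by (force simp: H_def tight_def)
    qed
    ultimately show ?thesis using hit by blast
  qed
qed

text \<open>The unit vectors off the support \<open>M\<close> are tight normals. Completing them to
  a basis of tight normals adds \<open>card M\<close> vectors, all of them 0/1 normals of subset
  sums equal to 1. With these as the rows labelled by \<open>M\<close>, the matrix \<open>A\<close>
  is block triangular, so its block on \<open>M\<close> is invertible and sends the restriction of
  \<open>u\<close> to the all-ones vector.\<close>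

lemma vertex_in_U':
  fixes u :: "real^'n"
  assumes u: "\<And>i. 0 \<le> u $ i" "1 \<le> indvec UNIV \<bullet> u"
    and full: "span (fst ` tight u) = UNIV"
  shows "u \<in> U'"
proof -
  define M where "M = {i. u $ i \<noteq> 0}"
  define S where "S = (\<lambda>i. axis i 1 :: real^'n) ` (- M)"
  have "S \<subseteq> Basis" by (auto simp: S_def axis_in_Basis_iff)
  then have indS: "independent S" using independent_Basis independent_mono by blast
  have SV: "S \<subseteq> fst ` tight u"
  proof
    fix v assume "v \<in> S"
    then obtain i where i: "u $ i = 0" "v = axis i 1" by (auto simp: S_def M_def)
    then have "(v, 0) \<in> tight u" by (auto simp: tight_def faces_def inner_axis')
    then show "v \<in> fst ` tight u" by force
  qed
  obtain B where B: "S \<subseteq> B" "B \<subseteq> fst ` tight u" "independent B" "fst ` tight u \<subseteq> span B"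
    using maximal_independent_subset_extend[OF SV indS] .
  have spanB: "span B = UNIV"
    using full B(4) span_minimal[OF B(4) subspace_span] by auto
  have finB: "finite B" using B(3) independent_bound by blast
  have "card B = CARD('n)"
    using dim_eq_card_independent[OF B(3)] dim_span[of B] spanB by (simp add: dim_UNIV)
  moreover have "card S = card (- M)"
    unfolding S_def by (rule card_image) (simp add: inj_on_def axis_eq_axis)
  moreover have "CARD('n) = card M + card (- M)"
    by (metis Compl_partition card_Un_disjoint finite inf_compl_bot)
  ultimately have "card (B - S) = card M"
    using B(1) finB by (simp add: card_Diff_subset finite_subset)
  then obtain r where r: "bij_betw r M (B - S)"
    using finB finite_same_card_bij[of M "B - S"] by auto
  define A :: "real^'n^'n" where "A = (\<chi> i. if i \<in> M then r i else axis i 1)"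
  have A: "A $ i = (if i \<in> M then r i else axis i 1)" for i by (simp add: A_def)
  have "B \<subseteq> rows A"
  proof
    fix v assume "v \<in> B"
    show "v \<in> rows A"
    proof (cases "v \<in> S")
      case True
      then obtain i where "i \<notin> M" "v = axis i 1" by (auto simp: S_def)
      then have "v = row i A" by (simp add: row_def A vec_nth_inverse)
      then show ?thesis by (auto simp: rows_def)
    next
      case False
      then obtain i where "i \<in> M" "v = r i" using r \<open>v \<in> B\<close> by (force simp: bij_betw_def)
      then have "v = row i A" by (simp add: row_def A vec_nth_inverse)
      then show ?thesis by (auto simp: rows_def)
    qed
  qed
  then have "span (rows A) = UNIV" using span_mono spanB by blast
  then obtain C where CA: "C ** A = mat 1" using matrix_left_invertible_span_rows by blast
  then have AC: "A ** C = mat 1" by (simp add: matrix_left_right_inverse)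
  have CA': "(\<Sum>j\<in>UNIV. C $ i $ j * A $ j $ k) = (if i = k then 1 else 0)" for i k
    using CA by (simp add: matrix_matrix_mult_def mat_def vec_eq_iff)
  have AC': "(\<Sum>j\<in>UNIV. A $ i $ j * C $ j $ k) = (if i = k then 1 else 0)" for i k
    using AC by (simp add: matrix_matrix_mult_def mat_def vec_eq_iff)
  have split: "(\<Sum>j\<in>UNIV. f j) = (\<Sum>j\<in>M. f j) + (\<Sum>j\<in>-M. f j)" for f :: "'n \<Rightarrow> real"
    by (metis Compl_eq_Diff_UNIV add.commute finite_class.finite_UNIV subset_UNIV sum.subset_diff)
  \<comment> \<open>Unit rows of \<open>A\<close> outside \<open>M\<close> force unit rows of
    \<open>C\<close> there, so the block of \<open>C\<close> on \<open>M\<close> inverts that of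
    \<open>A\<close>.\<close>
  have C_out: "C $ i $ k = (if i = k then 1 else 0)" if "i \<notin> M" for i k
    using AC'[of i k] that by (simp add: A axis_def if_distrib if_distribR cong: if_cong)
  have A_M: "(\<forall>k. A $ i $ k \<in> {0, 1}) \<and> A $ i \<bullet> u = 1" if "i \<in> M" for i
  proof -
    have ri: "r i \<in> B" "r i \<notin> S" using r that by (auto simp: bij_betw_def)
    then obtain b where b: "(r i, b) \<in> tight u" using B(2) by auto
    \<comment> \<open>A tight equation \<open>u $ l = 0\<close> would put the unit vector into
      \<open>S\<close>, which \<open>r i\<close> avoids.\<close>
    have "(r i, b) \<notin> range (\<lambda>i. (axis i 1, 0))"
    proof
      assume "(r i, b) \<in> range (\<lambda>i. (axis i 1, 0))"
      then obtain l where "r i = axis l 1" "b = 0" by auto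
      with b ri show False by (auto simp: tight_def inner_axis' S_def M_def)
    qed
    then obtain T where "r i = indvec T" "b = 1" using b by (auto simp: tight_def faces_def)
    with b that show ?thesis by (simp add: tight_def A)
  qed
  have uC: "u $ i = (\<Sum>j\<in>M. C $ i $ j)" for i
  proof -
    have "u = C *v (A *v u)"
      by (simp add: matrix_vector_mul_assoc CA)
    moreover have Au: "(A *v u) $ j = (if j \<in> M then 1 else 0)" for j
      using A_M[of j] by (auto simp: matrix_mult_dot A inner_axis' M_def)
    moreover have "(C *v (A *v u)) $ i = (\<Sum>j\<in>UNIV. C $ i $ j * (if j \<in> M then 1 else 0))"
      by (simp only: matrix_vector_mult_def[of C] vec_lambda_beta Au)
    ultimately have "u $ i = (\<Sum>j\<in>UNIV. C $ i $ j * (if j \<in> M then 1 else 0))"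
      by simp
    then show ?thesis by (simp add: if_distrib sum.If_cases cong: if_cong)
  qed
  have "inverse_matrix_on M (\<lambda>i j. A $ i $ j) (\<lambda>i j. C $ i $ j)"
    unfolding inverse_matrix_on_def
  proof (intro conjI ballI)
    fix i k assume ik: "i \<in> M" "k \<in> M"
    have "(\<Sum>j\<in>-M. A $ i $ j * C $ j $ k) = 0"
      using ik by (intro sum.neutral) (auto simp: C_out)
    then show "(\<Sum>j\<in>M. A $ i $ j * C $ j $ k) = (if i = k then 1 else 0)"
      using AC'[of i k] split[of "\<lambda>j. A $ i $ j * C $ j $ k"] by simp
    have "(\<Sum>j\<in>-M. C $ i $ j * A $ j $ k) = 0"
      using ik by (intro sum.neutral) (auto simp: A axis_def)
    then show "(\<Sum>j\<in>M. C $ i $ j * A $ j $ k) = (if i = k then 1 else 0)"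
      using CA'[of i k] split[of "\<lambda>j. C $ i $ j * A $ j $ k"] by simp
  qed
  moreover have "u \<noteq> 0" using u(2) by auto
  then have "M \<noteq> {}" by (auto simp: M_def vec_eq_iff)
  moreover have "\<forall>i\<in>M. \<forall>j\<in>M. A $ i $ j \<in> {0, 1}" using A_M by blast
  moreover have "\<forall>i. i \<notin> M \<longrightarrow> u $ i = 0" by (simp add: M_def)
  moreover have "\<forall>i\<in>M. u $ i = (\<Sum>j\<in>M. C $ i $ j * 1)" by (simp flip: uC)
  ultimately have "\<exists>M B C. M \<noteq> {} \<and> (\<forall>i\<in>M. \<forall>j\<in>M. B i j \<in> {0, 1::real}) \<and>
      inverse_matrix_on M B C \<and> (\<forall>i\<in>M. u $ i = (\<Sum>j\<in>M. C i j * 1)) \<and>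
      (\<forall>i. i \<notin> M \<longrightarrow> u $ i = 0)"
    by - (rule exI[of _ M], rule exI[of _ "\<lambda>i j. A $ i $ j"],
        rule exI[of _ "\<lambda>i j. C $ i $ j"], intro conjI)
  then show ?thesis using u(1) by (simp add: U'_def)
qed

text \<open>Induction on the number of faces that are not tight. Unless the tight normals span,
  \<open>u\<close> moves orthogonally to them without reducing the violation until a further face
  becomes tight.\<close>

lemma descent_to_U':
  fixes u :: "real^'n" and S :: "nat \<Rightarrow> real^'n"
  assumes y: "\<And>i. 0 \<le> y $ i"
    and z: "\<And>i. 0 \<le> z i" "\<And>i. z i \<le> 1" "\<And>i j. 1 \<le> i \<Longrightarrow> i \<le> j \<Longrightarrow> j \<le> n \<Longrightarrow> z j \<le> z i"
    and u: "\<And>i. 0 \<le> u $ i" "1 \<le> indvec UNIV \<bullet> u"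
    and viol: "w + u \<bullet> y < greedy z n (\<lambda>k. F_mix q c u (S k))"
  shows "\<exists>u\<in>U'. w + u \<bullet> y < greedy z n (\<lambda>k. F_mix q c u (S k))"
  using u viol
proof (induction "card (faces - tight u)" arbitrary: u rule: less_induct)
  case less
  note u = less.prems(1,2)
  define \<Phi> where "\<Phi> u = w + u \<bullet> y - greedy z n (\<lambda>k. F_mix q c u (S k))" for u
  show ?case
  proof (cases "span (fst ` tight u) = UNIV")
    case True
    then show ?thesis using vertex_in_U'[OF u] less.prems(3) by blast
  next
    case False
    then obtain d where d: "d \<noteq> 0" "\<And>v. v \<in> span (fst ` tight u) \<Longrightarrow> d \<bullet> v = 0"
      using span_not_UNIV_orthogonal by blast
    let ?h = "\<lambda>k i. h_mix q c i (S k)"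
    \<comment> \<open>These minimizing indices, chosen at \<open>u\<close>, stay minimizing on the
      same side, so \<open>\<Phi>\<close> is affine there.\<close>
    obtain j where j: "\<And>k. indvec {i. ?h k (j k) < ?h k i} \<bullet> u \<le> 1"
        "\<And>k. 1 \<le> indvec {i. ?h k (j k) \<le> ?h k i} \<bullet> u"
    proof -
      have "\<forall>k. \<exists>j. indvec {i. ?h k j < ?h k i} \<bullet> u \<le> 1 \<and> 1 \<le> indvec {i. ?h k j \<le> ?h k i} \<bullet> u"
        using hinge_breakpoint[OF u(2)] by metis
      then show ?thesis using that by metis
    qed
    define slope where
      "slope e = e \<bullet> y - greedy z n (\<lambda>k. \<Sum>i\<in>UNIV. e $ i * max 0 (?h k i - ?h k (j k)))" for e
    have affine: "\<Phi> (u + t *\<^sub>R e) = \<Phi> u + t * slope e" if side: "same_side u (u + t *\<^sub>R e)" for t e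
    proof -
      have "F_mix q c (u + t *\<^sub>R e) (S k) =
          F_mix q c u (S k) + t * (\<Sum>i\<in>UNIV. e $ i * max 0 (?h k i - ?h k (j k)))" for k
      proof -
        have "F_mix q c (u + t *\<^sub>R e) (S k) = hinge (u + t *\<^sub>R e) (?h k) (?h k (j k))"
          by (intro F_mix_eqI same_side_nonneg[OF side u(1)] same_side_indvec[OF side] j)
        also have "\<dots> = hinge u (?h k) (?h k (j k))
            + t * (\<Sum>i\<in>UNIV. e $ i * max 0 (?h k i - ?h k (j k)))"
          by (simp add: hinge_def sum.distrib sum_distrib_left algebra_simps)
        also have "hinge u (?h k) (?h k (j k)) = F_mix q c u (S k)"
          by (intro F_mix_eqI[symmetric] u j)
        finally show ?thesis .
      qed
      then show ?thesis
        by (simp add: \<Phi>_def slope_def greedy_add greedy_mult inner_add_left algebra_simps)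
    qed
    have slope_minus: "slope (- e) = - slope e" for e
      using greedy_mult[of z n "- 1"] by (simp add: slope_def sum_negf)
    \<comment> \<open>Either \<open>d\<close> or \<open>- d\<close> has negative slope, or the slope
      is 0; then the sign is chosen so that some coordinate decreases and the ray must leave the
      nonnegative orthant.\<close>
    have "\<exists>e. (\<forall>p\<in>tight u. fst p \<bullet> e = 0) \<and> (slope e < 0 \<or> slope e = 0 \<and> (\<exists>i. e $ i < 0))"
    proof -
      have d0: "\<forall>p\<in>tight u. fst p \<bullet> d = 0 \<and> fst p \<bullet> (- d) = 0"
        using d(2) by (metis imageI inner_commute inner_minus_right neg_equal_0_iff_equal span_base)
      obtain i where "d $ i \<noteq> 0" using d(1) by (auto simp: vec_eq_iff)
      then have "d $ i < 0 \<or> (- d) $ i < 0" by auto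
      then show ?thesis
        using d0 slope_minus[of d] by (smt (verit))
    qed
    then obtain e where e: "\<And>p. p \<in> tight u \<Longrightarrow> fst p \<bullet> e = 0"
        "slope e < 0 \<or> slope e = 0 \<and> (\<exists>i. e $ i < 0)"
      by blast
    consider (hit) t where "0 < t" "tight u \<subset> tight (u + t *\<^sub>R e)" "same_side u (u + t *\<^sub>R e)"
      | (free) "\<And>t. 0 \<le> t \<Longrightarrow> same_side u (u + t *\<^sub>R e)"
      using first_hit[of u e] e(1) by blast
    then show ?thesis
    proof cases
      case (hit t)
      have "faces - tight (u + t *\<^sub>R e) \<subset> faces - tight u"
        using hit(2) by (auto simp: tight_def)
      then have "card (faces - tight (u + t *\<^sub>R e)) < card (faces - tight u)"
        by (intro psubset_card_mono) (auto simp: finite_faces)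
      moreover have "t * slope e \<le> 0"
        using e(2) hit(1) by (auto simp: mult_le_0_iff)
      then have "\<Phi> (u + t *\<^sub>R e) < 0"
        using less.prems(3) affine[OF hit(3)] by (simp add: \<Phi>_def)
      ultimately show ?thesis
        using less.hyps[of "u + t *\<^sub>R e"] same_side_nonneg[OF hit(3) u(1)]
          same_side_indvec(2)[OF hit(3) u(2)]
        by (simp add: \<Phi>_def)
    next
      case free
      have "slope e \<noteq> 0"
      proof
        assume "slope e = 0"
        then obtain i where i: "e $ i < 0" using e(2) by auto
        \<comment> \<open>At this time coordinate \<open>i\<close> would equal -1.\<close>
        define t where "t = (u $ i + 1) / (- e $ i)"
        have "0 \<le> t" using u(1)[of i] i by (simp add: t_def divide_nonneg_neg)
        then have "0 \<le> (u + t *\<^sub>R e) $ i" using same_side_nonneg free u(1) by blast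
        moreover have "t * e $ i = - (u $ i + 1)" using i by (simp add: t_def)
        ultimately show False by simp
      qed
      then have neg: "slope e < 0" using e(2) by auto
      define b where "b = Max ((\<lambda>k. Max (range (?h k))) ` {..n})"
      have low: "w - b \<le> \<Phi> (u + t *\<^sub>R e)" if "0 \<le> t" for t
      proof -
        have "greedy z n (\<lambda>k. F_mix q c (u + t *\<^sub>R e) (S k)) \<le> b"
        proof (rule greedy_le[OF _ z])
          fix k assume "k \<le> n"
          then have "Max (range (?h k)) \<le> b" unfolding b_def by (intro Max_ge) auto
          then show "F_mix q c (u + t *\<^sub>R e) (S k) \<le> b"
            using F_mix_le_Max order_trans by blast
        qed
        moreover have "0 \<le> (u + t *\<^sub>R e) \<bullet> y"
          unfolding inner_vec_def inner_real_def
          by (intro sum_nonneg mult_nonneg_nonneg y same_side_nonneg[OF free[OF that] u(1)])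
        ultimately show ?thesis by (simp add: \<Phi>_def)
      qed
      \<comment> \<open>By affinity, \<open>\<Phi>\<close> would be below its uniform bound
        \<open>w - b\<close> at this time.\<close>
      define t where "t = (\<bar>\<Phi> u\<bar> + \<bar>w - b\<bar> + 1) / (- slope e)"
      have "0 \<le> t" using neg by (simp add: t_def divide_nonneg_neg)
      moreover have "t * slope e = - (\<bar>\<Phi> u\<bar> + \<bar>w - b\<bar> + 1)" using neg by (simp add: t_def)
      ultimately show ?thesis using low[of t] affine[OF free, of t] by simp
    qed
  qed
qed

section \<open>Sorting permutations and linear functionals along a chain\<close>

lemma sorting_bijection:
  fixes x :: "'n::finite \<Rightarrow> real"
  obtains \<delta> where "bij_betw \<delta> {1..CARD('n)} UNIV"
    "\<And>i j. 1 \<le> i \<Longrightarrow> i \<le> j \<Longrightarrow> j \<le> CARD('n) \<Longrightarrow> x (\<delta> j) \<le> x (\<delta> i)"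
proof -
  obtain xs :: "'n list" where xs: "set xs = UNIV" "distinct xs"
    using finite_distinct_list[OF finite[of UNIV]] by blast
  \<comment> \<open>The negated key sorts by decreasing \<open>x\<close>; the shift
    \<open>k - 1\<close> below turns positions from 1 into list indices from 0.\<close>
  define ys where "ys = sort_key (\<lambda>i. - x i) xs"
  have ys: "set ys = UNIV" "distinct ys" "sorted (map (\<lambda>i. - x i) ys)"
    using xs by (simp_all add: ys_def)
  have len: "length ys = CARD('n)"
    using distinct_card[OF ys(2)] ys(1) by simp
  have "bij_betw ((!) ys) {..<CARD('n)} UNIV"
    using bij_betw_nth[OF ys(2)] ys(1) len by simp
  moreover have "bij_betw (\<lambda>k. k - 1) {1..CARD('n)} {..<CARD('n)}"
    by (rule bij_betw_byWitness[of _ Suc]) auto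
  ultimately have "bij_betw ((!) ys \<circ> (\<lambda>k. k - 1)) {1..CARD('n)} UNIV"
    by (meson bij_betw_trans)
  moreover have "x (ys ! (j - 1)) \<le> x (ys ! (i - 1))"
    if "1 \<le> i" "i \<le> j" "j \<le> CARD('n)" for i j
    using sorted_nth_mono[OF ys(3), of "i - 1" "j - 1"] that len by simp
  ultimately show ?thesis using that[of "(!) ys \<circ> (\<lambda>k. k - 1)"] by auto
qed

text \<open>The increments of a linear functional along the chain are its coordinates. This later
  cancels the part of the separating functional acting on \<open>x\<close>.\<close>

lemma greedy_unit_sum:
  fixes x p :: "real^'n"
  assumes "bij_betw \<delta> {1..CARD('n)} UNIV"
  shows "greedy (\<lambda>i. x $ \<delta> i) CARD('n) (\<lambda>k. p \<bullet> unit_sum \<delta> k) = p \<bullet> x"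
proof -
  have step: "p \<bullet> unit_sum \<delta> i - p \<bullet> unit_sum \<delta> (i - 1) = p $ \<delta> i" if i: "1 \<le> i" for i
  proof -
    obtain k where "i = Suc k" using i by (cases i) auto
    then show ?thesis by (simp add: unit_sum_def inner_add_right inner_axis)
  qed
  have "greedy (\<lambda>i. x $ \<delta> i) CARD('n) (\<lambda>k. p \<bullet> unit_sum \<delta> k)
      = (\<Sum>i = 1..CARD('n). p $ \<delta> i * x $ \<delta> i)"
    using step by (simp add: greedy_def unit_sum_def[of _ 0])
  also have "\<dots> = (\<Sum>i\<in>UNIV. p $ i * x $ i)"
    using sum.reindex_bij_betw[OF assms, of "\<lambda>i. p $ i * x $ i"] by simp
  finally show ?thesis by (simp add: inner_vec_def)
qed

subsection \<open>Separation from the convex hull\<close>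

text \<open>The directions in which \<open>(w, y)\<close> can move indefinitely for fixed binary
  \<open>x\<close>: \<open>w\<close> may decrease if every \<open>y $ i\<close> increases at least
  as fast.\<close>

definition recession :: "(real \<times> (real^'n) \<times> (real^'n)) set" where
  "recession = {r. snd (snd r) = 0 \<and>
     (\<forall>i. 0 \<le> fst (snd r) $ i \<and> 0 \<le> fst r + fst (snd r) $ i)}"

text \<open>For fixed binary \<open>x\<close> and \<open>w\<close>, the least feasible \<open>y\<close> is piecewise affine in \<open>w\<close>, with
  breakpoints at the values \<open>h_mix q c j x\<close>.\<close>

definition kink :: "real^'n \<Rightarrow> real^'n \<Rightarrow> 'n set \<times> 'n \<Rightarrow> real \<times> (real^'n) \<times> (real^'n)" where
  "kink q c = (\<lambda>(X, j).
     (h_mix q c j (indvec X),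
      \<chi> i. max 0 (h_mix q c i (indvec X) - h_mix q c j (indvec X)),
      indvec X))"

lemma kink_plus_recession:
  assumes "r \<in> recession"
  shows "kink q c s + r \<in> P_MCMIX q c"
proof -
  obtain X j where s: "s = (X, j)" by (cases s)
  obtain a b where r: "r = (a, b, 0)" and ab: "\<And>i. 0 \<le> b $ i" "\<And>i. 0 \<le> a + b $ i"
    using assms by (cases r) (auto simp: recession_def)
  have "h_mix q c i (indvec X)
      - (max 0 (h_mix q c i (indvec X) - h_mix q c j (indvec X)) + b $ i)
      \<le> h_mix q c j (indvec X) + a" for i
    using ab(2)[of i] by simp
  then show ?thesis
    using ab(1) unfolding s r kink_def P_MCMIX_def
    by (auto simp add: h_mix_def[of q c _ "indvec X"] simp del: indvec_nth intro: add_nonneg_nonneg)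
      (auto simp: h_mix_def)
qed

text \<open>The sum \<open>K\<close> of a polytope and a closed cone is closed and convex and lies
  in the hull, so the point is strictly separated from it. The normal is nonnegative on the cone,
  and three kinds of rays give the conditions on \<open>\<alpha>\<close> and
  \<open>u\<close>.\<close>

lemma separating_weights:
  fixes q c :: "real^'n"
  assumes out: "(w, y, x) \<notin> convex hull (P_MCMIX q c)"
    and y: "\<And>i. 0 \<le> y $ i"
  obtains \<alpha> u p where "0 \<le> \<alpha>" "\<And>i. 0 \<le> u $ i" "\<alpha> \<le> indvec UNIV \<bullet> u"
    "\<And>s. (\<alpha>, u, p) \<bullet> (w, y, x) < (\<alpha>, u, p) \<bullet> kink q c s"
proof -
  define V where "V = range (kink q c)"
  define K where "K = (\<Union>v\<in>convex hull V. \<Union>r\<in>recession. {v + r})"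
  have cD: "convex (recession :: (real \<times> (real^'n) \<times> (real^'n)) set)"
  proof (rule convexI)
    fix r s :: "real \<times> (real^'n) \<times> (real^'n)" and a b :: real
    assume *: "r \<in> recession" "s \<in> recession" "0 \<le> a" "0 \<le> b" "a + b = 1"
    show "a *\<^sub>R r + b *\<^sub>R s \<in> recession"
      unfolding recession_def
    proof (intro CollectI conjI allI)
      fix i
      have "0 \<le> a * (fst r + fst (snd r) $ i) + b * (fst s + fst (snd s) $ i)"
        using * by (intro add_nonneg_nonneg[OF mult_nonneg_nonneg mult_nonneg_nonneg])
          (auto simp: recession_def)
      then show "0 \<le> fst (a *\<^sub>R r + b *\<^sub>R s) + fst (snd (a *\<^sub>R r + b *\<^sub>R s)) $ i"
        by (simp add: algebra_simps)
    qed (use * in \<open>auto simp: recession_def\<close>)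
  qed
  have clD: "closed (recession :: (real \<times> (real^'n) \<times> (real^'n)) set)"
    unfolding recession_def
    by (intro closed_Collect_conj closed_Collect_all closed_Collect_eq closed_Collect_le
        continuous_intros)
  have "finite V" by (simp add: V_def)
  then have "closed K"
    unfolding K_def by (intro compact_closed_sums finite_imp_compact_convex_hull clD)
  moreover have "convex K"
    unfolding K_def by (intro convex_sums convex_convex_hull cD)
  moreover have "K \<subseteq> convex hull (P_MCMIX q c)"
  proof -
    \<comment> \<open>The points whose translates by \<open>recession\<close> all lie in the hull
      form a convex set, so only the kinks need checking.\<close>
    have "convex hull V \<subseteq> {v. \<forall>r\<in>recession. v + r \<in> convex hull (P_MCMIX q c)}"
    proof (rule hull_minimal)
      show "V \<subseteq> {v. \<forall>r\<in>recession. v + r \<in> convex hull (P_MCMIX q c)}"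
        unfolding V_def
        by (intro subsetI CollectI ballI hull_inc) (erule imageE, simp only: kink_plus_recession)
      show "convex {v. \<forall>r\<in>recession. v + r \<in> convex hull (P_MCMIX q c)}"
      proof (rule convexI, clarify)
        fix v v' r :: "real \<times> (real^'n) \<times> (real^'n)" and a b :: real
        assume *: "\<forall>r\<in>recession. v + r \<in> convex hull (P_MCMIX q c)"
          "\<forall>r\<in>recession. v' + r \<in> convex hull (P_MCMIX q c)"
          "0 \<le> a" "0 \<le> b" "a + b = 1" "r \<in> recession"
        have "a *\<^sub>R v + b *\<^sub>R v' + r = a *\<^sub>R (v + r) + b *\<^sub>R (v' + r)"
          using *(5) by (simp add: algebra_simps flip: scaleR_add_left)
        then show "a *\<^sub>R v + b *\<^sub>R v' + r \<in> convex hull (P_MCMIX q c)"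
          using * convexD[OF convex_convex_hull] by metis
      qed
    qed
    then show ?thesis unfolding K_def by (intro UN_least) blast
  qed
  then have "(w, y, x) \<notin> K" using out by blast
  ultimately have "\<exists>a \<beta>. a \<bullet> (w, y, x) < \<beta> \<and> (\<forall>v\<in>K. \<beta> < a \<bullet> v)"
    by (intro separating_hyperplane_closed_point)
  then obtain a \<beta> where sep: "a \<bullet> (w, y, x) < \<beta>" "\<And>v. v \<in> K \<Longrightarrow> \<beta> < a \<bullet> v"
    by (elim exE conjE) (rule that, assumption, erule bspec)
  have kinkK: "kink q c s + r \<in> K" if "r \<in> recession" for s r
    using that hull_inc[of "kink q c s" V] by (auto simp: K_def V_def)
  have pos: "0 \<le> a \<bullet> r" if r: "r \<in> recession" for r
  proof (rule ccontr)
    assume neg: "\<not> 0 \<le> a \<bullet> r"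
    let ?v = "kink q c undefined"
    \<comment> \<open>Scaled by this \<open>t\<close>, a direction of negative value would bring the
      functional down to at most \<open>\<beta>\<close>.\<close>
    define t where "t = (\<bar>a \<bullet> ?v\<bar> + \<bar>\<beta>\<bar>) / (- (a \<bullet> r))"
    have "0 \<le> t" using neg by (simp add: t_def divide_nonneg_neg)
    then have "t *\<^sub>R r \<in> recession"
      using r by (auto simp: recession_def simp flip: distrib_left)
    then have "\<beta> < a \<bullet> ?v + t * (a \<bullet> r)"
      using sep(2)[OF kinkK, of "t *\<^sub>R r" undefined]
      by (simp only: inner_add_right inner_scaleR_right)
    moreover have "t * (a \<bullet> r) = - (\<bar>a \<bullet> ?v\<bar> + \<bar>\<beta>\<bar>)" using neg by (simp add: t_def)
    ultimately show False by simp
  qed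
  obtain \<alpha> u p where a: "a = (\<alpha>, u, p)" by (cases a)
  show ?thesis
  proof
    show "0 \<le> \<alpha>" using pos[of "(1, 0, 0)"] by (simp add: a recession_def)
    show "0 \<le> u $ i" for i
    proof -
      have "(0, axis i 1, 0) \<in> recession" by (simp add: recession_def axis_def)
      from pos[OF this] show ?thesis by (simp add: a inner_axis)
    qed
    show "\<alpha> \<le> indvec UNIV \<bullet> u"
      using pos[of "(- 1, indvec UNIV, 0)"] by (simp add: a recession_def inner_commute)
    have zero: "0 \<in> recession" by (simp add: recession_def)
    show "(\<alpha>, u, p) \<bullet> (w, y, x) < (\<alpha>, u, p) \<bullet> kink q c s" for s
      using less_trans[OF sep(1) sep(2)[OF kinkK[OF zero, of s]]] by (simp only: a add_0_right)
  qed
qed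

section \<open>From separation to a violated greedy inequality\<close>

lemma MISEPI_violated:
  fixes q c :: "real^'n"
  assumes out: "(w, y, x) \<notin> convex hull (P_MCMIX q c)"
    and y: "\<And>i. 0 \<le> y $ i" and x: "\<And>i. 0 \<le> x $ i" "\<And>i. x $ i \<le> 1"
  obtains u \<delta> where "u \<in> U'" "bij_betw \<delta> {1..CARD('n)} UNIV" "\<not> MISEPI q c u \<delta> w y x"
proof -
  obtain \<delta> where \<delta>: "bij_betw \<delta> {1..CARD('n)} UNIV"
    "\<And>i j. 1 \<le> i \<Longrightarrow> i \<le> j \<Longrightarrow> j \<le> CARD('n) \<Longrightarrow> x $ \<delta> j \<le> x $ \<delta> i"
    using sorting_bijection[of "\<lambda>i. x $ i"] by blast
  obtain \<alpha> u p where \<alpha>: "0 \<le> \<alpha>" and u: "\<And>i. 0 \<le> u $ i" "\<alpha> \<le> indvec UNIV \<bullet> u"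
    and sep: "\<And>s. (\<alpha>, u, p) \<bullet> (w, y, x) < (\<alpha>, u, p) \<bullet> kink q c s"
    using separating_weights[OF out y] by blast
  let ?S = "unit_sum \<delta>" and ?n = "CARD('n)"
  note avg = greedy_ge[where n = ?n and z = "\<lambda>i. x $ \<delta> i", OF _ x(1) x(2) \<delta>(2)]
  have kink: "(\<alpha>, u, p) \<bullet> kink q c (\<delta> ` {1..k}, j) =
      \<alpha> * h_mix q c j (?S k) + (\<Sum>i\<in>UNIV. u $ i * max 0 (h_mix q c i (?S k) - h_mix q c j (?S k)))
      + p \<bullet> ?S k" if "k \<le> ?n" for k j
    by (simp add: kink_def unit_sum_indvec[OF \<delta>(1) that] inner_vec_def[of u])
  \<comment> \<open>If \<open>\<alpha> = 0\<close>, the kink at the largest \<open>h_mix\<close> has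
    zero \<open>y\<close> part, which leaves only \<open>p\<close> on the right. Averaging along the
    chain gives \<open>u \<bullet> y + p \<bullet> x < p \<bullet> x\<close>, impossible for
    nonnegative \<open>u\<close> and \<open>y\<close>.\<close>
  have "\<alpha> \<noteq> 0"
  proof
    assume "\<alpha> = 0"
    have "u \<bullet> y + p \<bullet> x < p \<bullet> ?S k" if "k \<le> ?n" for k
    proof -
      let ?h = "\<lambda>i. h_mix q c i (?S k)"
      have "Max (range ?h) \<in> range ?h" by (rule Max_in) auto
      then obtain j where "Max (range ?h) = ?h j" by fastforce
      then have "?h i \<le> ?h j" for i by (metis Max_ge finite finite_imageI rangeI)
      then have "max 0 (?h i - ?h j) = 0" for i by (simp add: max.absorb1)
      then have "(\<Sum>i\<in>UNIV. u $ i * max 0 (?h i - ?h j)) = 0" by simp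
      then show ?thesis
        using sep[of "(\<delta> ` {1..k}, j)"] kink[OF that, of j] \<open>\<alpha> = 0\<close> by simp
    qed
    then have "\<exists>m. u \<bullet> y + p \<bullet> x < m \<and> (\<forall>k\<le>?n. m \<le> p \<bullet> ?S k)"
      by (intro exI[of _ "Min ((\<lambda>k. p \<bullet> ?S k) ` {..?n})"]) auto
    then obtain m where m: "u \<bullet> y + p \<bullet> x < m" "\<And>k. k \<le> ?n \<Longrightarrow> m \<le> p \<bullet> ?S k" by blast
    have "m \<le> p \<bullet> x" using avg[where m = m and f = "\<lambda>k. p \<bullet> ?S k"] m(2) greedy_unit_sum[OF \<delta>(1)] by simp
    moreover have "0 \<le> u \<bullet> y"
      unfolding inner_vec_def inner_real_def by (intro sum_nonneg mult_nonneg_nonneg u y)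
    ultimately show False using m(1) by simp
  qed
  then have "0 < \<alpha>" using \<alpha> by simp
  define v where "v = (1 / \<alpha>) *\<^sub>R u"
  define r where "r = (1 / \<alpha>) *\<^sub>R p"
  have uv: "u = \<alpha> *\<^sub>R v" "p = \<alpha> *\<^sub>R r" using \<open>0 < \<alpha>\<close> by (auto simp: v_def r_def)
  have v: "0 \<le> v $ i" for i using u(1) \<alpha> by (simp add: v_def)
  have v1: "1 \<le> indvec UNIV \<bullet> v" using u(2) \<open>0 < \<alpha>\<close> by (simp add: v_def)
  have "w + v \<bullet> y + r \<bullet> x < F_mix q c v (?S k) + r \<bullet> ?S k" if "k \<le> ?n" for k
  proof -
    obtain j where j: "F_mix q c v (?S k) = hinge v (\<lambda>i. h_mix q c i (?S k)) (h_mix q c j (?S k))"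
      by (rule F_mix_attained)
    have "(\<alpha>, u, p) \<bullet> (w, y, x) = \<alpha> * (w + v \<bullet> y + r \<bullet> x)"
      by (simp add: uv algebra_simps)
    moreover have "(\<alpha>, u, p) \<bullet> kink q c (\<delta> ` {1..k}, j) = \<alpha> * (F_mix q c v (?S k) + r \<bullet> ?S k)"
      unfolding kink[OF that] j hinge_def
      by (simp add: uv algebra_simps sum_distrib_left)
    ultimately show ?thesis using sep[of "(\<delta> ` {1..k}, j)"] \<open>0 < \<alpha>\<close> by simp
  qed
  \<comment> \<open>The chain is finite, so a common bound \<open>m\<close> keeps the inequality
    strict under averaging; then \<open>r \<bullet> x\<close> cancels.\<close>
  then have "\<exists>m. w + v \<bullet> y + r \<bullet> x < m \<and> (\<forall>k\<le>?n. m \<le> F_mix q c v (?S k) + r \<bullet> ?S k)"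
    by (intro exI[of _ "Min ((\<lambda>k. F_mix q c v (?S k) + r \<bullet> ?S k) ` {..?n})"]) auto
  then obtain m where m: "w + v \<bullet> y + r \<bullet> x < m"
      "\<And>k. k \<le> ?n \<Longrightarrow> m \<le> F_mix q c v (?S k) + r \<bullet> ?S k" by blast
  have "m \<le> greedy (\<lambda>i. x $ \<delta> i) ?n (\<lambda>k. F_mix q c v (?S k)) + r \<bullet> x"
    using avg[where m = m and f = "\<lambda>k. F_mix q c v (?S k) + r \<bullet> ?S k"] m(2) greedy_unit_sum[OF \<delta>(1)]
    by (simp add: greedy_add)
  then have "w + v \<bullet> y < greedy (\<lambda>i. x $ \<delta> i) ?n (\<lambda>k. F_mix q c v (?S k))"
    using m(1) by simp
  from descent_to_U'[where z = "\<lambda>i. x $ \<delta> i" and S = ?S, OF y x(1) x(2) \<delta>(2) v v1 this]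
  obtain u' where "u' \<in> U'"
      "w + u' \<bullet> y < greedy (\<lambda>i. x $ \<delta> i) ?n (\<lambda>k. F_mix q c u' (?S k))" by blast
  then show ?thesis using that[OF _ \<delta>(1)] by (simp add: MISEPI_greedy)
qed

text \<open>For fixed \<open>u\<close> and \<open>\<delta>\<close> the inequality is affine in the
  point; the constant \<open>f 0\<close> is where \<open>a + b = 1\<close> enters.\<close>

lemma convex_MISEPI: "convex {(w, y, x). MISEPI q c u \<delta> w y x}"
proof -
  have conv: "greedy (\<lambda>i. (a *\<^sub>R x + b *\<^sub>R x') $ \<delta> i) n f
      = a * greedy (\<lambda>i. x $ \<delta> i) n f + b * greedy (\<lambda>i. x' $ \<delta> i) n f"
    if "a + b = 1" for a b x x' n and f :: "nat \<Rightarrow> real"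
  proof -
    have "f 0 = a * f 0 + b * f 0" using that by (simp flip: distrib_right)
    moreover have "(\<Sum>i = 1..n. (f i - f (i - 1)) * (a *\<^sub>R x + b *\<^sub>R x') $ \<delta> i)
        = a * (\<Sum>i = 1..n. (f i - f (i - 1)) * x $ \<delta> i)
        + b * (\<Sum>i = 1..n. (f i - f (i - 1)) * x' $ \<delta> i)"
      by (simp only: vector_add_component vector_scaleR_component real_scaleR_def distrib_left
          sum.distrib sum_distrib_left mult.left_commute)
    ultimately show ?thesis
      unfolding greedy_def distrib_left by linarith
  qed
  have "a * s + b * s' \<le> a * w + b * w' + u \<bullet> (a *\<^sub>R y + b *\<^sub>R y')"
    if "s \<le> w + u \<bullet> y" "s' \<le> w' + u \<bullet> y'" "0 \<le> a" "0 \<le> b" for a b s s' w w' y y'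
    using mult_left_mono[OF that(1,3)] mult_left_mono[OF that(2,4)]
    by (simp add: inner_add_right algebra_simps)
  then show ?thesis
    unfolding MISEPI_greedy by (intro convexI) (clarsimp simp only: split_paired_all mem_Collect_eq
      prod.case scaleR_Pair add_Pair real_scaleR_def conv)
qed

theorem corollary5p40:
  fixes q c :: "real^'n"
  assumes "\<forall>i. 0 \<le> c $ i"
  shows "convex hull (P_MCMIX q c) =
    {(w, y, x). (\<forall>i. 0 \<le> y $ i) \<and> (\<forall>i. 0 \<le> x $ i \<and> x $ i \<le> 1) \<and>
       (\<forall>u\<in>U'. \<forall>\<delta>. bij_betw \<delta> {1..CARD('n)} UNIV \<longrightarrow> MISEPI q c u \<delta> w y x)}"
    (is "_ = ?Q")
proof
  let ?box = "{(w :: real, y :: real^'n, x :: real^'n).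
    (\<forall>i. 0 \<le> y $ i) \<and> (\<forall>i. 0 \<le> x $ i \<and> x $ i \<le> 1)}"
  have Q: "?Q = ?box \<inter> (\<Inter>u\<in>U'. \<Inter>\<delta>\<in>{\<delta>. bij_betw \<delta> {1..CARD('n)} UNIV}.
      {(w, y, x). MISEPI q c u \<delta> w y x})"
    by auto
  have "convex ?box"
    by (intro convexI) (auto intro!: convex_bound_le)
  then have "convex ?Q"
    unfolding Q by (intro convex_Int convex_INT convex_MISEPI)
  moreover have "P_MCMIX q c \<subseteq> ?Q"
  proof clarify
    fix w and y x :: "real^'n"
    assume p: "(w, y, x) \<in> P_MCMIX q c"
    have "MISEPI q c u \<delta> w y x" if "u \<in> U'" "bij_betw \<delta> {1..CARD('n)} UNIV" for u \<delta>
      using that p assms U'_sum_ge_1[OF that(1)] by (intro MISEPI_binary) (auto simp: U'_def)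
    moreover have "0 \<le> y $ i \<and> 0 \<le> x $ i \<and> x $ i \<le> 1" for i
    proof -
      have "x $ i \<in> {0, 1}" "0 \<le> y $ i" using p by (auto simp: P_MCMIX_def)
      then show ?thesis by auto
    qed
    ultimately show "(\<forall>i. 0 \<le> y $ i) \<and> (\<forall>i. 0 \<le> x $ i \<and> x $ i \<le> 1) \<and>
        (\<forall>u\<in>U'. \<forall>\<delta>. bij_betw \<delta> {1..CARD('n)} UNIV \<longrightarrow> MISEPI q c u \<delta> w y x)"
      by blast
  qed
  ultimately show "convex hull (P_MCMIX q c) \<subseteq> ?Q"
    by (rule hull_minimal[rotated])
  show "?Q \<subseteq> convex hull (P_MCMIX q c)"
  proof clarify
    fix w and y x :: "real^'n"
    assume "\<forall>i. 0 \<le> y $ i" "\<forall>i. 0 \<le> x $ i \<and> x $ i \<le> 1"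
      "\<forall>u\<in>U'. \<forall>\<delta>. bij_betw \<delta> {1..CARD('n)} UNIV \<longrightarrow> MISEPI q c u \<delta> w y x"
    then show "(w, y, x) \<in> convex hull (P_MCMIX q c)"
      using MISEPI_violated by metis
  qed
qed

end
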